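(* Let $(X_n)_{n\ge1}$ be independent identically distributed real random variables whose common distribution function $F_X$ is absolutely continuous with density $f_X$, and let $B_{n+1}=\max(0,B_n+X_{n+1})$ on the state space $[0,\infty)$. Let $\Pi_n$ be the law of $B_n$ and $G_n(b)=\mathbb{P}(B_n\le b)$, and suppose that $\Pi_n$ has the decomposition $\Pi_n=p_{0,n}\,\delta_0+g_n(s)\,\mathrm{d}s$ on $[0,\infty)$, where $p_{0,n}=\Pi_n(\{0\})$ and $g_n$ is a density on $(0,\infty)$. Then, for every $n\ge0$, $$p_{0,n+1}=G_{n+1}(0)=\int_{[0,\infty)}F_X(-s)\,\Pi_n(\mathrm{d}s),\qquad G_{n+1}(b)=\int_{[0,\infty)}F_X(b-s)\,\Pi_n(\mathrm{d}s)\quad (b>0),$$ and $$p_{0,n+1}=p_{0,n}\,F_X(0)+\int_0^\infty F_X(-s)\,g_n(s)\,\mathrm{d}s,$$ $$g_{n+1}(b)=p_{0,n}\,f_X(b)+\int_0^\infty f_X(b-s)\,g_n(s)\,\mathrm{d}s,\qquad b>0,$$ the last identity being understood for Lebesgue-almost every $b>0$.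
   Context: In the application, $X_n=-Y_n-a$, where $Y_n$ are the increments of the primary power source and $a>0$ is the maximum tolerable drop in grid power per time step; $B_n$ is the battery power. The initial value $B_0=b_0\in[0,\infty)$ is a given constant. The standing assumption is that each $\Pi_n$ has no singular continuous part and that its only possible atom is $0$. $\delta_0$ is the Dirac measure at $0$. *)

theory Defs
  imports "HOL-Probability.Probability"
begin

primrec battery :: "real \<Rightarrow> (nat \<Rightarrow> 'a \<Rightarrow> real) \<Rightarrow> nat \<Rightarrow> 'a \<Rightarrow> real" where
  "battery b0 X 0 \<omega> = b0"
| "battery b0 X (Suc n) \<omega> = max 0 (battery b0 X n \<omega> + X (Suc n) \<omega>)"

(* The law is a measure on all of real; since b0 >= 0 it is concentrated on {0..}. *)
definition battery_law :: "'a measure \<Rightarrow> real \<Rightarrow> (nat \<Rightarrow> 'a \<Rightarrow> real) \<Rightarrow> nat \<Rightarrow> real measure" where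
  "battery_law M b0 X n = distr M borel (battery b0 X n)"

definition battery_cdf :: "'a measure \<Rightarrow> real \<Rightarrow> (nat \<Rightarrow> 'a \<Rightarrow> real) \<Rightarrow> nat \<Rightarrow> real \<Rightarrow> real" where
  "battery_cdf M b0 X n b = measure M {\<omega> \<in> space M. battery b0 X n \<omega> \<le> b}"

definition atom_at_zero :: "real measure \<Rightarrow> real" where
  "atom_at_zero \<mu> = measure \<mu> {0}"

(* \<mu> = p0 \<delta>_0 + g(s) ds on [0,\<infinity>), with p0 = \<mu>({0}).  Only the values of g on (0,\<infinity>)
   matter, and g is not normalised: its total mass is 1 - p0 if \<mu> is a probability on [0,\<infinity>). *)
definition atom_density_decomposition :: "real measure \<Rightarrow> (real \<Rightarrow> real) \<Rightarrow> bool" where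
  "atom_density_decomposition \<mu> g \<longleftrightarrow>
     set_borel_measurable borel {0<..} g \<and>
     (\<forall>s>0. 0 \<le> g s) \<and>
     (\<forall>A\<in>sets borel. A \<subseteq> {0..} \<longrightarrow>
        emeasure \<mu> A =
          ennreal (atom_at_zero \<mu>) * emeasure (return borel 0) A +
          (\<integral>\<^sup>+ s \<in> A \<inter> {0<..}. ennreal (g s) \<partial>lborel))"

end

theory Submission
  imports Defs
begin

text \<open>
  The increment \<open>X\<^sub>n\<^sub>+\<^sub>1\<close> is independent of \<open>B\<^sub>n\<close>, so \<open>B\<^sub>n + X\<^sub>n\<^sub>+\<^sub>1\<close> has the law \<open>\<Pi>\<^sub>n \<star> \<nu>\<close>, where
  \<open>\<nu>\<close> is the law of \<open>X\<^sub>1\<close>. Truncation at \<open>0\<close> changes neither the events \<open>B\<^sub>n\<^sub>+\<^sub>1 \<le> b\<close> with \<open>b \<ge> 0\<close>,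
  which gives the distribution functions, nor the restriction of the law to \<open>(0,\<infinity>)\<close>. By Tonelli
  that restriction has the density \<open>b \<mapsto> \<integral> f\<^sub>X(b - s) \<Pi>\<^sub>n(ds)\<close>, and uniqueness of densities
  identifies it with \<open>g\<^sub>n\<^sub>+\<^sub>1\<close>.
\<close>

section \<open>The battery path and its independence of the next increment\<close>

lemma battery_nonneg: "0 \<le> b0 \<Longrightarrow> 0 \<le> battery b0 X n \<omega>"
  by (cases n) auto

text \<open>The two sample points may lie in different spaces: this allows \<open>battery\<close> on
  the original space to be compared with \<open>battery\<close> on a space of paths.\<close>

lemma battery_cong: "(\<And>i. i \<in> {1..n} \<Longrightarrow> X i \<omega> = Y i \<omega>') \<Longrightarrow> battery b0 X n \<omega> = battery b0 Y n \<omega>'"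
  by (induction n) auto

lemma battery_measurable:
  "(\<And>i. i \<in> {1..n} \<Longrightarrow> X i \<in> borel_measurable M) \<Longrightarrow> battery b0 X n \<in> borel_measurable M"
proof (induction n)
  case 0
  have "battery b0 X 0 = (\<lambda>_. b0)" by (simp add: fun_eq_iff)
  then show ?case by simp
next
  case (Suc n)
  have [measurable]: "battery b0 X n \<in> borel_measurable M" "X (Suc n) \<in> borel_measurable M"
    using Suc by auto
  have "battery b0 X (Suc n) = (\<lambda>\<omega>. max 0 (battery b0 X n \<omega> + X (Suc n) \<omega>))"
    by (simp add: fun_eq_iff)
  then show ?case by simp
qed

text \<open>The index blocks \<open>{1..n}\<close> and \<open>{Suc n}\<close> are disjoint, so the
  corresponding tuples of increments are independent. \<open>battery b0 X n\<close> is a measurable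
  function of the first tuple, \<open>X (Suc n)\<close> a coordinate of the second.\<close>

lemma (in prob_space) indep_var_battery:
  assumes "indep_vars (\<lambda>_. borel) X {1..}"
  shows "indep_var borel (battery b0 X n) borel (X (Suc n))"
proof -
  \<comment> \<open>The battery on path space, driven by the coordinate maps. It reads only the
    coordinates \<open>1\<close> to \<open>n\<close>, so restricting the path to these loses
    nothing.\<close>
  let ?B = "battery b0 (\<lambda>i w. w i) n"
  have "indep_var borel (?B \<circ> (\<lambda>\<omega>. restrict (\<lambda>i. X i \<omega>) {1..n}))
          borel ((\<lambda>w. w (Suc n)) \<circ> (\<lambda>\<omega>. restrict (\<lambda>i. X i \<omega>) {Suc n}))"
    by (rule indep_var_compose[OF indep_var_restrict[OF assms]])
      (auto intro!: battery_measurable)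
  moreover have "?B \<circ> (\<lambda>\<omega>. restrict (\<lambda>i. X i \<omega>) {1..n}) = battery b0 X n"
    by (auto simp: fun_eq_iff intro!: battery_cong)
  moreover have "(\<lambda>w. w (Suc n)) \<circ> (\<lambda>\<omega>. restrict (\<lambda>i. X i \<omega>) {Suc n}) = X (Suc n)"
    by (auto simp: fun_eq_iff)
  ultimately show ?thesis by simp
qed

section \<open>Convolutions: distribution functions and densities\<close>

lemma measure_convolution_atMost:
  fixes \<mu> \<nu> :: "real measure"
  assumes "prob_space \<mu>" "prob_space \<nu>" and sets: "sets \<mu> = sets borel" "sets \<nu> = sets borel"
  shows "measure (\<mu> \<star> \<nu>) {..b} = (LINT s|\<mu>. cdf \<nu> (b - s))"
    and "integrable \<mu> (\<lambda>s. cdf \<nu> (b - s))"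
proof -
  interpret \<mu>: prob_space \<mu> by fact
  interpret \<nu>: prob_space \<nu> by fact
  interpret \<nu>: real_distribution \<nu>
    using sets by (simp add: real_distribution_def real_distribution_axioms_def \<nu>.prob_space_axioms sets_eq_imp_space_eq)
  note [measurable_cong] = sets
  have "mono (cdf \<nu>)" by (simp add: monoI \<nu>.cdf_nondecreasing)
  then have [measurable]: "cdf \<nu> \<in> borel_measurable borel" by (rule borel_measurable_mono)
  show int: "integrable \<mu> (\<lambda>s. cdf \<nu> (b - s))"
    by (rule \<mu>.integrable_const_bound[where B=1]) (auto simp: \<nu>.cdf_nonneg \<nu>.cdf_bounded_prob)
  have "emeasure (\<mu> \<star> \<nu>) {..b} = (\<integral>\<^sup>+s. emeasure \<nu> {a. a + s \<in> {..b}} \<partial>\<mu>)"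
    using sets sets_eq_imp_space_eq[OF sets(1)] sets_eq_imp_space_eq[OF sets(2)]
    by (intro convolution_emeasure \<mu>.finite_measure_axioms \<nu>.finite_measure_axioms) auto
  also have "\<dots> = (\<integral>\<^sup>+s. ennreal (cdf \<nu> (b - s)) \<partial>\<mu>)"
  proof (rule nn_integral_cong)
    fix s
    have "{a. a + s \<in> {..b}} = {..b - s}" by auto
    then show "emeasure \<nu> {a. a + s \<in> {..b}} = ennreal (cdf \<nu> (b - s))"
      by (simp add: cdf_def \<nu>.emeasure_eq_measure)
  qed
  also have "\<dots> = ennreal (LINT s|\<mu>. cdf \<nu> (b - s))"
    by (rule nn_integral_eq_integral[OF int]) (simp add: \<nu>.cdf_nonneg)
  finally show "measure (\<mu> \<star> \<nu>) {..b} = (LINT s|\<mu>. cdf \<nu> (b - s))"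
    by (simp add: measure_def integral_nonneg_AE \<nu>.cdf_nonneg)
qed

text \<open>A translation moves the shift by \<open>s\<close> from the set to the density, after
  which the two integrals are interchanged. Only the second factor needs a density, so
  \<open>\<mu>\<close> may keep its atom; values in \<open>ennreal\<close> avoid any integrability
  condition on the kernel.\<close>

lemma density_convolution:
  fixes \<mu> :: "real measure" and f :: "real \<Rightarrow> ennreal"
  assumes "finite_measure \<mu>" and sets: "sets \<mu> = sets borel"
    and f[measurable]: "f \<in> borel_measurable borel" and "finite_measure (density lborel f)"
  shows "\<mu> \<star> density lborel f = density lborel (\<lambda>b. \<integral>\<^sup>+s. f (b - s) \<partial>\<mu>)"
    and "(\<lambda>b. \<integral>\<^sup>+s. f (b - s) \<partial>\<mu>) \<in> borel_measurable borel"
proof -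
  interpret \<mu>: finite_measure \<mu> by fact
  interpret pair_sigma_finite \<mu> lborel ..
  note [measurable_cong] = sets
  show m[measurable]: "(\<lambda>b. \<integral>\<^sup>+s. f (b - s) \<partial>\<mu>) \<in> borel_measurable borel"
    by measurable
  show "\<mu> \<star> density lborel f = density lborel (\<lambda>b. \<integral>\<^sup>+s. f (b - s) \<partial>\<mu>)"
  proof (rule measure_eqI)
    fix A assume "A \<in> sets (\<mu> \<star> density lborel f)"
    then have [measurable]: "A \<in> sets borel" by simp
    have "emeasure (\<mu> \<star> density lborel f) A
        = (\<integral>\<^sup>+s. \<integral>\<^sup>+x. indicator A (s + x) \<partial>density lborel f \<partial>\<mu>)"
      using assms by (intro convolution_emeasure') auto
    also have "\<dots> = (\<integral>\<^sup>+s. \<integral>\<^sup>+x. f x * indicator A (s + x) \<partial>lborel \<partial>\<mu>)"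
      by (intro nn_integral_cong) (simp add: nn_integral_density)
    also have "\<dots> = (\<integral>\<^sup>+s. \<integral>\<^sup>+b. f (b - s) * indicator A b \<partial>lborel \<partial>\<mu>)"
    proof (rule nn_integral_cong)
      fix s
      \<comment> \<open>Substitution \<open>x = b - s\<close>, under which Lebesgue measure is
        invariant.\<close>
      show "(\<integral>\<^sup>+x. f x * indicator A (s + x) \<partial>lborel) = (\<integral>\<^sup>+b. f (b - s) * indicator A b \<partial>lborel)"
        by (subst nn_integral_real_affine[where c=1 and t="-s"]) (auto simp: algebra_simps)
    qed
    also have "\<dots> = (\<integral>\<^sup>+b. \<integral>\<^sup>+s. f (b - s) * indicator A b \<partial>\<mu> \<partial>lborel)"
      by (rule Fubini'[symmetric]) measurable
    also have "\<dots> = (\<integral>\<^sup>+b. (\<integral>\<^sup>+s. f (b - s) \<partial>\<mu>) * indicator A b \<partial>lborel)"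
      by (intro nn_integral_cong nn_integral_multc) measurable
    also have "\<dots> = emeasure (density lborel (\<lambda>b. \<integral>\<^sup>+s. f (b - s) \<partial>\<mu>)) A"
      by (simp add: emeasure_density)
    finally show "emeasure (\<mu> \<star> density lborel f) A
        = emeasure (density lborel (\<lambda>b. \<integral>\<^sup>+s. f (b - s) \<partial>\<mu>)) A" .
  qed simp
qed

section \<open>Integration against an atom at zero plus a density\<close>

context
  fixes \<mu> :: "real measure" and g :: "real \<Rightarrow> real"
  assumes sets: "sets \<mu> = sets borel" and decomposition: "atom_density_decomposition \<mu> g"
begin

text \<open>\<open>g\<close> is unconstrained outside \<open>{0<..}\<close>, so measurability is
  available only for its product with the indicator.\<close>

lemma decomposition_density_measurable:
  "(\<lambda>s. indicator {0<..} s * g s) \<in> borel_measurable borel"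
  "(\<lambda>s. ennreal (g s) * indicator {0<..} s) \<in> borel_measurable borel"
proof -
  show m[measurable]: "(\<lambda>s. indicator {0<..} s * g s) \<in> borel_measurable borel"
    using decomposition by (simp add: atom_density_decomposition_def set_borel_measurable_def)
  have "(\<lambda>s. ennreal (g s) * indicator {0<..} s) = (\<lambda>s. ennreal (indicator {0<..} s * g s))"
    by (auto simp: fun_eq_iff indicator_def)
  then show "(\<lambda>s. ennreal (g s) * indicator {0<..} s) \<in> borel_measurable borel"
    by simp
qed

text \<open>A set of the form \<open>A \<inter> {0<..}\<close> misses \<open>0\<close>, so the Dirac
  term vanishes and only the density term is left.\<close>

lemma decomposition_density_eq:
  "density \<mu> (indicator {0<..}) = density lborel (\<lambda>s. ennreal (g s) * indicator {0<..} s)"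
proof (rule measure_eqI)
  note [measurable_cong] = sets
  note [measurable] = decomposition_density_measurable
  fix A assume "A \<in> sets (density \<mu> (indicator {0<..}))"
  then have A[measurable]: "A \<in> sets borel" using sets by simp
  have "emeasure (density \<mu> (indicator {0<..})) A = emeasure \<mu> (A \<inter> {0<..})"
    using sets by (subst emeasure_restricted) (auto simp: Int_commute)
  also have "\<dots> = (\<integral>\<^sup>+ s \<in> A \<inter> {0<..}. ennreal (g s) \<partial>lborel)"
  proof -
    have "A \<inter> {0<..} \<in> sets borel" "A \<inter> {0<..} \<subseteq> {0..}" by auto
    then have "emeasure \<mu> (A \<inter> {0<..}) =
          ennreal (atom_at_zero \<mu>) * emeasure (return borel 0) (A \<inter> {0<..}) +
          (\<integral>\<^sup>+ s \<in> (A \<inter> {0<..}) \<inter> {0<..}. ennreal (g s) \<partial>lborel)"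
      using decomposition unfolding atom_density_decomposition_def by blast
    then show ?thesis by (simp add: Int_assoc)
  qed
  also have "\<dots> = emeasure (density lborel (\<lambda>s. ennreal (g s) * indicator {0<..} s)) A"
    by (subst emeasure_density) (auto intro!: nn_integral_cong split: split_indicator)
  finally show "emeasure (density \<mu> (indicator {0<..})) A
      = emeasure (density lborel (\<lambda>s. ennreal (g s) * indicator {0<..} s)) A" .
qed (simp add: sets)

text \<open>Up to a \<open>\<mu>\<close>-null set the line is \<open>{0}\<close> together with
  \<open>{0<..}\<close>. The first piece contributes the atom, and on the second
  \<open>\<mu>\<close> is replaced by its density.\<close>

lemma nn_integral_decomposition:
  assumes "finite_measure \<mu>" and nonneg: "AE s in \<mu>. 0 \<le> s"
    and h: "h \<in> borel_measurable borel"
  shows "(\<integral>\<^sup>+s. h s \<partial>\<mu>) = ennreal (atom_at_zero \<mu>) * h 0 + (\<integral>\<^sup>+s\<in>{0<..}. h s * ennreal (g s) \<partial>lborel)"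
proof -
  interpret finite_measure \<mu> by fact
  note [measurable_cong] = sets
  note [measurable] = decomposition_density_measurable h
  have "(\<integral>\<^sup>+s. h s \<partial>\<mu>) = (\<integral>\<^sup>+s. h s * indicator {0} s + indicator {0<..} s * h s \<partial>\<mu>)"
    using nonneg by (intro nn_integral_cong_AE) (auto elim!: eventually_mono simp: indicator_def)
  also have "\<dots> = (\<integral>\<^sup>+s. h s * indicator {0} s \<partial>\<mu>) + (\<integral>\<^sup>+s. indicator {0<..} s * h s \<partial>\<mu>)"
    by (rule nn_integral_add) measurable
  also have "(\<integral>\<^sup>+s. h s * indicator {0} s \<partial>\<mu>) = (\<integral>\<^sup>+s. h 0 * indicator {0} s \<partial>\<mu>)"
    by (intro nn_integral_cong) (simp add: indicator_def)
  also have "\<dots> = ennreal (atom_at_zero \<mu>) * h 0"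
    by (subst nn_integral_cmult_indicator)
      (auto simp: sets atom_at_zero_def emeasure_eq_measure mult.commute)
  also have "(\<integral>\<^sup>+s. indicator {0<..} s * h s \<partial>\<mu>) = (\<integral>\<^sup>+s. h s \<partial>density \<mu> (indicator {0<..}))"
    by (rule nn_integral_density[symmetric]) measurable
  also have "\<dots> = (\<integral>\<^sup>+s. ennreal (g s) * indicator {0<..} s * h s \<partial>lborel)"
    unfolding decomposition_density_eq by (rule nn_integral_density) measurable
  finally show ?thesis by (simp add: ac_simps)
qed

text \<open>Passes from \<open>ennreal\<close> to real integrals. The real value \<open>r\<close>
  makes the whole nonnegative integral finite, hence also its part over \<open>{0<..}\<close>;
  integrability is thus a consequence and need not be known beforehand. This matters because the
  Bochner integral of a non-integrable function is \<open>0\<close> by default.\<close>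

lemma integral_decomposition:
  assumes "finite_measure \<mu>" and "AE s in \<mu>. 0 \<le> s"
    and h: "h \<in> borel_measurable borel" and h0: "\<And>s. 0 \<le> h s"
    and eq: "(\<integral>\<^sup>+s. ennreal (h s) \<partial>\<mu>) = ennreal r" and r: "0 \<le> r"
  shows "set_integrable lborel {0<..} (\<lambda>s. h s * g s)"
    and "r = atom_at_zero \<mu> * h 0 + (LINT s:{0<..}|lborel. h s * g s)"
proof -
  note [measurable] = decomposition_density_measurable h
  \<comment> \<open>The indicator is attached to \<open>g\<close>, the grouping for which
    measurability is known.\<close>
  let ?k = "\<lambda>s. h s * (indicator {0<..} s * g s)"
  have k: "(\<lambda>s. indicator {0<..} s *\<^sub>R (h s * g s)) = ?k"
    by (auto simp: fun_eq_iff)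
  have k0: "0 \<le> ?k s" for s
    using decomposition h0 by (auto simp: atom_density_decomposition_def indicator_def)
  have "ennreal r = ennreal (atom_at_zero \<mu>) * ennreal (h 0)
      + (\<integral>\<^sup>+s\<in>{0<..}. ennreal (h s) * ennreal (g s) \<partial>lborel)"
    unfolding eq[symmetric] using assms by (intro nn_integral_decomposition) auto
  also have "(\<integral>\<^sup>+s\<in>{0<..}. ennreal (h s) * ennreal (g s) \<partial>lborel) = (\<integral>\<^sup>+s. ennreal (?k s) \<partial>lborel)"
    by (intro nn_integral_cong) (auto simp: indicator_def ennreal_mult' h0)
  finally have r_eq: "ennreal r = ennreal (atom_at_zero \<mu>) * ennreal (h 0) + (\<integral>\<^sup>+s. ennreal (?k s) \<partial>lborel)" .
  then have "(\<integral>\<^sup>+s. ennreal (?k s) \<partial>lborel) < \<infinity>"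
    by (metis ennreal_add_eq_top ennreal_neq_top infinity_ennreal_def less_top)
  then have int: "integrable lborel ?k"
    using k0 by (intro integrableI_nonneg) auto
  then show "set_integrable lborel {0<..} (\<lambda>s. h s * g s)"
    unfolding set_integrable_def k .
  have a0: "0 \<le> atom_at_zero \<mu>" by (simp add: atom_at_zero_def)
  have i0: "0 \<le> integral\<^sup>L lborel ?k" using k0 by (simp add: integral_nonneg_AE)
  have "ennreal r = ennreal (atom_at_zero \<mu> * h 0 + integral\<^sup>L lborel ?k)"
    using r_eq nn_integral_eq_integral[OF int] k0 h0 a0 i0
    by (simp add: ennreal_mult ennreal_plus)
  \<comment> \<open>\<open>ennreal\<close> sends negative reals to \<open>0\<close>, so cancelling
    it requires both sides to be nonnegative.\<close>
  then have "r = atom_at_zero \<mu> * h 0 + integral\<^sup>L lborel ?k"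
    using r h0 a0 i0 by (subst (asm) ennreal_inj) auto
  then show "r = atom_at_zero \<mu> * h 0 + (LINT s:{0<..}|lborel. h s * g s)"
    unfolding set_lebesgue_integral_def k .
qed

end

section \<open>The recursions for the distribution function, the atom and the density\<close>

theorem mainTheorem3:
  fixes M :: "'a measure"
    and X :: "nat \<Rightarrow> 'a \<Rightarrow> real"
    and f\<^sub>X F\<^sub>X :: "real \<Rightarrow> real"
    and b0 :: real
    and g :: "nat \<Rightarrow> real \<Rightarrow> real"
    and \<mu> :: "nat \<Rightarrow> real measure"
    and G :: "nat \<Rightarrow> real \<Rightarrow> real"
    and p0 :: "nat \<Rightarrow> real"
  assumes "prob_space M"
    and "prob_space.indep_vars M (\<lambda>_. borel) X {1..}"
    and "\<forall>n\<ge>1. distr M borel (X n) = distr M borel (X 1)"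
    and "\<forall>x. 0 \<le> f\<^sub>X x"
    and "distributed M lborel (X 1) (\<lambda>x. ennreal (f\<^sub>X x))"
    and "F\<^sub>X = cdf (distr M borel (X 1))"
    and "0 \<le> b0"
    and "\<mu> = battery_law M b0 X"
    and "G = battery_cdf M b0 X"
    and "p0 = (\<lambda>n. atom_at_zero (\<mu> n))"
  shows "\<forall>n.
      p0 (Suc n) = G (Suc n) 0 \<and>
      G (Suc n) 0 = (LINT s:{0..}|\<mu> n. F\<^sub>X (- s)) \<and>
      (\<forall>b>0. G (Suc n) b = (LINT s:{0..}|\<mu> n. F\<^sub>X (b - s))) \<and>
      (atom_density_decomposition (\<mu> n) (g n) \<longrightarrow>
         p0 (Suc n) = p0 n * F\<^sub>X 0 + (LINT s:{0<..}|lborel. F\<^sub>X (- s) * g n s)) \<and>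
      (atom_density_decomposition (\<mu> n) (g n) \<and>
       atom_density_decomposition (\<mu> (Suc n)) (g (Suc n)) \<longrightarrow>
         (AE b in lborel. 0 < b \<longrightarrow>
            set_integrable lborel {0<..} (\<lambda>s. f\<^sub>X (b - s) * g n s) \<and>
            g (Suc n) b = p0 n * f\<^sub>X b + (LINT s:{0<..}|lborel. f\<^sub>X (b - s) * g n s)))"
proof (rule allI)
  fix n
  interpret prob_space M by fact
  have b0: "0 \<le> b0" and f0: "\<And>x. 0 \<le> f\<^sub>X x" using assms(4,7) by auto
  have X_meas: "X i \<in> borel_measurable M" if "i \<in> {1..}" for i
    using assms(2) that by (auto simp: indep_vars_def2)
  have B_meas[measurable]: "battery b0 X m \<in> borel_measurable M" for m
    by (rule battery_measurable) (simp add: X_meas)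
  have X_Suc[measurable]: "X (Suc n) \<in> borel_measurable M" by (simp add: X_meas)
  define \<nu> where "\<nu> = distr M borel (X 1)"
  \<comment> \<open>\<open>distributed\<close> describes the law as a measure on
    \<open>lborel\<close>; since \<open>lborel\<close> and \<open>borel\<close> have the same sets,
    this is the same measure as \<open>\<nu>\<close>.\<close>
  have \<nu>_dens: "\<nu> = density lborel (\<lambda>x. ennreal (f\<^sub>X x))"
    using distributed_distr_eq_density[OF assms(5)] unfolding \<nu>_def
    by (metis distr_cong sets_lborel)
  have f_meas[measurable]: "f\<^sub>X \<in> borel_measurable borel"
    using distributed_real_measurable[OF _ assms(5)] f0 by simp
  have \<mu>_eq: "\<mu> m = distr M borel (battery b0 X m)" for m
    using assms(8) by (simp add: battery_law_def)
  have sets_\<mu>[measurable_cong]: "sets (\<mu> m) = sets borel" for m by (simp add: \<mu>_eq)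
  have sets_\<nu>: "sets \<nu> = sets borel" by (simp add: \<nu>_def)
  have prob_\<mu>: "prob_space (\<mu> m)" for m unfolding \<mu>_eq by (rule prob_space_distr) measurable
  have prob_\<nu>: "prob_space \<nu>" unfolding \<nu>_def by (rule prob_space_distr) (simp add: X_meas)
  have fin_\<mu>: "finite_measure (\<mu> m)" for m using prob_\<mu> by (simp add: prob_space_def)
  have fin_\<nu>: "finite_measure (density lborel (\<lambda>x. ennreal (f\<^sub>X x)))"
    using prob_\<nu> unfolding \<nu>_dens by (simp add: prob_space_def)
  have \<mu>_nonneg: "AE s in \<mu> m. 0 \<le> s" for m
    unfolding \<mu>_eq by (subst AE_distr_iff) (auto simp: battery_nonneg b0)
  have F: "F\<^sub>X = cdf \<nu>" using assms(6) by (simp add: \<nu>_def)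

  \<comment> \<open>Independence gives a convolution with the law of \<open>X (Suc n)\<close>, which
    identical distribution replaces by \<open>\<nu>\<close>.\<close>
  have sum_law: "distr M borel (\<lambda>\<omega>. battery b0 X n \<omega> + X (Suc n) \<omega>) = (\<mu> n \<star> \<nu>)"
    using sum_indep_random_variable[OF indep_var_battery[OF assms(2)]] assms(3)[rule_format, of "Suc n"]
    by (simp add: \<mu>_eq \<nu>_def)

  have G_eq: "G (Suc n) b = (LINT s|\<mu> n. F\<^sub>X (b - s))" if "0 \<le> b" for b
  proof -
    have "G (Suc n) b = measure M ((\<lambda>\<omega>. battery b0 X n \<omega> + X (Suc n) \<omega>) -` {..b} \<inter> space M)"
      unfolding assms(9) battery_cdf_def using that
      by (intro arg_cong[where f="measure M"]) auto
    also have "\<dots> = measure (\<mu> n \<star> \<nu>) {..b}"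
      unfolding sum_law[symmetric] by (rule measure_distr[symmetric]) auto
    also have "\<dots> = (LINT s|\<mu> n. F\<^sub>X (b - s))"
      unfolding F by (rule measure_convolution_atMost[OF prob_\<mu> prob_\<nu> sets_\<mu> sets_\<nu>])
    finally show ?thesis .
  qed
  have int_F: "integrable (\<mu> n) (\<lambda>s. F\<^sub>X (b - s))" for b
    unfolding F by (rule measure_convolution_atMost[OF prob_\<mu> prob_\<nu> sets_\<mu> sets_\<nu>])
  have F0: "0 \<le> F\<^sub>X x" for x by (simp add: F cdf_def)
  \<comment> \<open>Measurability is read off from integrability, as \<open>\<mu> n\<close> has the
    Borel sets.\<close>
  have F_meas: "(\<lambda>s. F\<^sub>X (b - s)) \<in> borel_measurable borel" for b
    using borel_measurable_integrable[OF int_F[of b]] sets_\<mu>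
    by (simp cong: measurable_cong_sets)
  \<comment> \<open>\<open>\<mu> n\<close> is a measure on the whole line, but the negative
    half-line is null for it.\<close>
  have restrict: "(LINT s|\<mu> n. F\<^sub>X (b - s)) = (LINT s:{0..}|\<mu> n. F\<^sub>X (b - s))" for b
    unfolding set_lebesgue_integral_def using \<mu>_nonneg[of n] F_meas[of b] sets_\<mu>
    by (intro integral_cong_AE) (auto elim!: eventually_mono)

  \<comment> \<open>After a step the battery is a maximum with \<open>0\<close>, so being at most
    \<open>0\<close> means being equal to \<open>0\<close>.\<close>
  have p0_eq: "p0 (Suc n) = G (Suc n) 0"
  proof -
    have "p0 (Suc n) = measure M (battery b0 X (Suc n) -` {0} \<inter> space M)"
      unfolding assms(10) atom_at_zero_def \<mu>_eq by (rule measure_distr) auto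
    also have "\<dots> = G (Suc n) 0"
      unfolding assms(9) battery_cdf_def by (intro arg_cong[where f="measure M"]) auto
    finally show ?thesis .
  qed

  have atom_rec: "p0 (Suc n) = p0 n * F\<^sub>X 0 + (LINT s:{0<..}|lborel. F\<^sub>X (- s) * g n s)"
    if "atom_density_decomposition (\<mu> n) (g n)"
  proof -
    \<comment> \<open>The decomposition is applied to \<open>h s = F\<^sub>X (0 - s)\<close>, with
      \<open>r\<close> the value already found for \<open>G (Suc n) 0\<close>.\<close>
    have "(\<integral>\<^sup>+s. ennreal (F\<^sub>X (0 - s)) \<partial>\<mu> n) = ennreal (LINT s|\<mu> n. F\<^sub>X (0 - s))"
      by (rule nn_integral_eq_integral[OF int_F]) (simp add: F0)
    moreover have "0 \<le> (LINT s|\<mu> n. F\<^sub>X (0 - s))" by (simp add: integral_nonneg_AE F0)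
    ultimately show ?thesis
      using integral_decomposition(2)[OF sets_\<mu> that fin_\<mu> \<mu>_nonneg F_meas[of 0] F0]
      by (simp add: p0_eq G_eq fun_cong[OF assms(10), of n])
  qed

  have density_rec: "AE b in lborel. 0 < b \<longrightarrow>
      set_integrable lborel {0<..} (\<lambda>s. f\<^sub>X (b - s) * g n s) \<and>
      g (Suc n) b = p0 n * f\<^sub>X b + (LINT s:{0<..}|lborel. f\<^sub>X (b - s) * g n s)"
    if dec: "atom_density_decomposition (\<mu> n) (g n)"
      and dec': "atom_density_decomposition (\<mu> (Suc n)) (g (Suc n))"
  proof -
    let ?K = "\<lambda>b. \<integral>\<^sup>+s. ennreal (f\<^sub>X (b - s)) \<partial>\<mu> n"
    note conv = density_convolution[OF fin_\<mu>[of n] sets_\<mu> _ fin_\<nu>]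
    have K_meas[measurable]: "?K \<in> borel_measurable borel"
      by (rule conv) measurable
    note [measurable] = decomposition_density_measurable[OF sets_\<mu> dec']
    have "density (\<mu> (Suc n)) (indicator {0<..}) = density (\<mu> n \<star> \<nu>) (indicator {0<..})"
    proof (rule measure_eqI)
      fix A assume "A \<in> sets (density (\<mu> (Suc n)) (indicator {0<..}))"
      then have [measurable]: "A \<in> sets borel" using sets_\<mu> by simp
      have "emeasure (density (\<mu> (Suc n)) (indicator {0<..})) A = emeasure (\<mu> (Suc n)) ({0<..} \<inter> A)"
        by (rule emeasure_restricted) (auto simp: sets_\<mu>)
      also have "\<dots> = emeasure M (battery b0 X (Suc n) -` ({0<..} \<inter> A) \<inter> space M)"
        unfolding \<mu>_eq by (rule emeasure_distr) auto
      \<comment> \<open>Where \<open>max 0 y\<close> is positive it equals \<open>y\<close>, so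
        truncation leaves this event unchanged.\<close>
      also have "battery b0 X (Suc n) -` ({0<..} \<inter> A) \<inter> space M
          = (\<lambda>\<omega>. battery b0 X n \<omega> + X (Suc n) \<omega>) -` ({0<..} \<inter> A) \<inter> space M"
        by (auto simp: max_def split: if_splits)
      also have "emeasure M \<dots> = emeasure (\<mu> n \<star> \<nu>) ({0<..} \<inter> A)"
        unfolding sum_law[symmetric] by (rule emeasure_distr[symmetric]) auto
      also have "\<dots> = emeasure (density (\<mu> n \<star> \<nu>) (indicator {0<..})) A"
        by (rule emeasure_restricted[symmetric]) auto
      finally show "emeasure (density (\<mu> (Suc n)) (indicator {0<..})) A
          = emeasure (density (\<mu> n \<star> \<nu>) (indicator {0<..})) A" .
    qed (simp add: sets_\<mu>)
    also have "\<mu> n \<star> \<nu> = density lborel ?K"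
      unfolding \<nu>_dens by (rule conv) measurable
    also have "density \<dots> (indicator {0<..}) = density lborel (\<lambda>b. ?K b * indicator {0<..} b)"
      by (rule density_density_eq) auto
    finally have "density lborel (\<lambda>b. ennreal (g (Suc n) b) * indicator {0<..} b)
        = density lborel (\<lambda>b. ?K b * indicator {0<..} b)"
      unfolding decomposition_density_eq[OF sets_\<mu> dec'] .
    \<comment> \<open>Equal densities of one measure agree only almost everywhere; this is the
      source of the exceptional null set of \<open>b\<close>.\<close>
    then have "AE b in lborel. ennreal (g (Suc n) b) * indicator {0<..} b = ?K b * indicator {0<..} b"
      by (intro sigma_finite_measure.density_unique[OF sigma_finite_lborel]) auto
    then show ?thesis
    proof (rule eventually_mono, intro impI)
      fix b :: real
      assume "ennreal (g (Suc n) b) * indicator {0<..} b = ?K b * indicator {0<..} b" and b: "0 < b"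
      \<comment> \<open>At such a \<open>b\<close> the integral \<open>?K b\<close> is finite, being
        the image of a real number. This supplies the value \<open>r\<close> for
        \<open>h s = f\<^sub>X (b - s)\<close>, where \<open>h 0 = f\<^sub>X b\<close> accounts for
        the atom term.\<close>
      then have K: "?K b = ennreal (g (Suc n) b)" by simp
      have g0: "0 \<le> g (Suc n) b"
        using dec' b by (simp add: atom_density_decomposition_def)
      have h: "(\<lambda>s. f\<^sub>X (b - s)) \<in> borel_measurable borel" by measurable
      show "set_integrable lborel {0<..} (\<lambda>s. f\<^sub>X (b - s) * g n s) \<and>
          g (Suc n) b = p0 n * f\<^sub>X b + (LINT s:{0<..}|lborel. f\<^sub>X (b - s) * g n s)"
        using integral_decomposition[OF sets_\<mu> dec fin_\<mu> \<mu>_nonneg h f0 K g0]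
        by (simp add: assms(10))
    qed
  qed

  show "p0 (Suc n) = G (Suc n) 0 \<and>
      G (Suc n) 0 = (LINT s:{0..}|\<mu> n. F\<^sub>X (- s)) \<and>
      (\<forall>b>0. G (Suc n) b = (LINT s:{0..}|\<mu> n. F\<^sub>X (b - s))) \<and>
      (atom_density_decomposition (\<mu> n) (g n) \<longrightarrow>
         p0 (Suc n) = p0 n * F\<^sub>X 0 + (LINT s:{0<..}|lborel. F\<^sub>X (- s) * g n s)) \<and>
      (atom_density_decomposition (\<mu> n) (g n) \<and>
       atom_density_decomposition (\<mu> (Suc n)) (g (Suc n)) \<longrightarrow>
         (AE b in lborel. 0 < b \<longrightarrow>
            set_integrable lborel {0<..} (\<lambda>s. f\<^sub>X (b - s) * g n s) \<and>
            g (Suc n) b = p0 n * f\<^sub>X b + (LINT s:{0<..}|lborel. f\<^sub>X (b - s) * g n s)))"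
    using p0_eq G_eq restrict restrict[of 0] atom_rec density_rec by auto
qed

end
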